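(* Fix $\xi>0$. Let $\Gamma=\{(x(s),y(s)) \mid s\in[a,b]\}$ be an elastica (parameterized by planar arclength $s$), and let $\tilde\gamma=\{(\tilde x(t),\tilde y(t),\tilde\theta(t)) \mid t\in[\alpha,\beta]\}$ be a sub-Riemannian geodesic on $\mathrm{SE}(2)$ (with parameter $\xi$) such that $\dot{\tilde x}(t)^2+\dot{\tilde y}(t)^2\neq 0$ for all $t\in[\alpha,\beta]$. Let $s(t)=\int_\alpha^t\sqrt{\dot{\tilde x}(\tau)^2+\dot{\tilde y}(\tau)^2}\,d\tau$ for $t\in[\alpha,\beta]$, let $S=s(\beta)$, and let $t=t(s)$, $s\in[0,S]$, be the inverse function of $s(\cdot)$. If $$(x(s),y(s))=(\tilde x(t(s)),\tilde y(t(s)))\quad\text{for all } s\in(c,d)$$ for some interval $(c,d)\subset[a,b]\cap[0,S]$ with $c<d$, then both curves $\Gamma$ and $\tilde\Gamma=\{(\tilde x(t),\tilde y(t)) \mid t\in[\alpha,\beta]\}$ are straight line segments.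
   Context: The group $\mathrm{SE}(2)$ of Euclidean motions of the plane is identified with $\mathbb{R}^2\times S^1$, with coordinates $(x,y,\theta)$, $\theta\in\mathbb{R}/2\pi\mathbb{Z}$. Consider the vector fields $\mathcal{A}_1=\cos\theta\,\partial_x+\sin\theta\,\partial_y$ and $\mathcal{A}_2=\partial_\theta$. Prime denotes $\frac{d}{ds}$ and dot denotes $\frac{d}{dt}$. Elastica. Euler's elastica problem is: for $\gamma'=\mathcal{A}_1+u\,\mathcal{A}_2$ with fixed endpoints and fixed length, minimize $\int \frac{u^2}{2}\,ds$. Elasticae are the planar projections of its extremals (in the sense of the Pontryagin maximum principle; the abnormal ones are straight lines and are contained among the normal ones). Explicitly, an elastica is a planar curve $s\mapsto(x(s),y(s))$, $s\in[a,b]$, for which there exist functions $\theta,p_1,p_2,p_3$ on $[a,b]$ such that $$p_1'=0,\quad p_2'=0,\quad p_3'=p_1\sin\theta-p_2\cos\theta,\quad x'=\cos\theta,\quad y'=\sin\theta,\quad \theta'=p_3 .$$ Sub-Riemannian geodesic. The sub-Riemannian problem on $\mathrm{SE}(2)$ with parameter $\xi>0$ is: for $\dot{\tilde\gamma}=u_1\mathcal{A}_1+u_2\mathcal{A}_2$ with fixed endpoints, minimize $\int\sqrt{\xi^2u_1^2+u_2^2}\,dt$, equivalently (on a fixed time interval) $\int\frac{\xi^2u_1^2+u_2^2}{2}\,dt$. Sub-Riemannian geodesics are the projections to $\mathrm{SE}(2)$ of its Pontryagin extremals (nontrivial abnormal ones do not exist). Explicitly, a sub-Riemannian geodesic is a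 curve $t\mapsto(\tilde x(t),\tilde y(t),\tilde\theta(t))$, $t\in[\alpha,\beta]$, for which there exist functions $\tilde p_1,\tilde p_2,\tilde p_3$ on $[\alpha,\beta]$ such that, with $w=\tilde p_1\cos\tilde\theta+\tilde p_2\sin\tilde\theta$, $$\dot{\tilde p}_1=0,\quad \dot{\tilde p}_2=0,\quad \dot{\tilde p}_3=\frac{w\,(\tilde p_1\sin\tilde\theta-\tilde p_2\cos\tilde\theta)}{\xi^2},\quad \dot{\tilde x}=\frac{w}{\xi^2}\cos\tilde\theta,\quad \dot{\tilde y}=\frac{w}{\xi^2}\sin\tilde\theta,\quad \dot{\tilde\theta}=\tilde p_3 .$$ Here $a<b$ and $\alpha<\beta$ are real numbers, and the initial conditions of both systems are arbitrary. *)

theory Defs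
  imports "HOL-Analysis.Analysis"
begin

text \<open>
  Angles, elements of \<open>\<real>/2\<pi>\<int>\<close>, are represented throughout by differentiable real-valued lifts
  along the curve. The equations of motion depend on the angle only through its sine, cosine and
  derivative, so they are independent of the choice of the lift.
\<close>

text \<open>
  The momenta \<open>p\<^sub>1, p\<^sub>2, p\<^sub>3\<close> are adjoint to \<open>x, y, \<theta>\<close> in the normal Hamiltonian system of the Pontryagin
  maximum principle. Derivatives at the end points of the interval are one-sided.
\<close>

definition elastica :: "real \<Rightarrow> real \<Rightarrow> (real \<Rightarrow> real) \<Rightarrow> (real \<Rightarrow> real) \<Rightarrow> bool" where
  "elastica a b x y \<longleftrightarrow>
    (\<exists>\<theta> p\<^sub>1 p\<^sub>2 p\<^sub>3 :: real \<Rightarrow> real. \<forall>s\<in>{a..b}.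
       (p\<^sub>1 has_real_derivative 0) (at s within {a..b}) \<and>
       (p\<^sub>2 has_real_derivative 0) (at s within {a..b}) \<and>
       (p\<^sub>3 has_real_derivative p\<^sub>1 s * sin (\<theta> s) - p\<^sub>2 s * cos (\<theta> s)) (at s within {a..b}) \<and>
       (x has_real_derivative cos (\<theta> s)) (at s within {a..b}) \<and>
       (y has_real_derivative sin (\<theta> s)) (at s within {a..b}) \<and>
       (\<theta> has_real_derivative p\<^sub>3 s) (at s within {a..b}))"

definition sr_geodesic ::
  "real \<Rightarrow> real \<Rightarrow> real \<Rightarrow> (real \<Rightarrow> real) \<Rightarrow> (real \<Rightarrow> real) \<Rightarrow> (real \<Rightarrow> real) \<Rightarrow> bool" where
  "sr_geodesic \<xi> \<alpha> \<beta> x y \<theta> \<longleftrightarrow>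
    (\<exists>p\<^sub>1 p\<^sub>2 p\<^sub>3 :: real \<Rightarrow> real. \<forall>t\<in>{\<alpha>..\<beta>}.
       let w = p\<^sub>1 t * cos (\<theta> t) + p\<^sub>2 t * sin (\<theta> t) in
       (p\<^sub>1 has_real_derivative 0) (at t within {\<alpha>..\<beta>}) \<and>
       (p\<^sub>2 has_real_derivative 0) (at t within {\<alpha>..\<beta>}) \<and>
       (p\<^sub>3 has_real_derivative w * (p\<^sub>1 t * sin (\<theta> t) - p\<^sub>2 t * cos (\<theta> t)) / \<xi>\<^sup>2)
         (at t within {\<alpha>..\<beta>}) \<and>
       (x has_real_derivative w / \<xi>\<^sup>2 * cos (\<theta> t)) (at t within {\<alpha>..\<beta>}) \<and>
       (y has_real_derivative w / \<xi>\<^sup>2 * sin (\<theta> t)) (at t within {\<alpha>..\<beta>}) \<and>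
       (\<theta> has_real_derivative p\<^sub>3 t) (at t within {\<alpha>..\<beta>}))"

definition planar_speed ::
  "real \<Rightarrow> real \<Rightarrow> (real \<Rightarrow> real) \<Rightarrow> (real \<Rightarrow> real) \<Rightarrow> real \<Rightarrow> real" where
  "planar_speed \<alpha> \<beta> x y t =
     sqrt ((vector_derivative x (at t within {\<alpha>..\<beta>}))\<^sup>2 +
           (vector_derivative y (at t within {\<alpha>..\<beta>}))\<^sup>2)"

definition planar_arclength ::
  "real \<Rightarrow> real \<Rightarrow> (real \<Rightarrow> real) \<Rightarrow> (real \<Rightarrow> real) \<Rightarrow> real \<Rightarrow> real" where
  "planar_arclength \<alpha> \<beta> x y t = integral {\<alpha>..t} (planar_speed \<alpha> \<beta> x y)"

text \<open>
  The inverse of the arclength function restricted to \<open>[\<alpha>, \<beta>]\<close>. It is meaningful only on \<open>[0, S]\<close>,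
  with \<open>S\<close> the total length, and only if the arclength function is injective on \<open>[\<alpha>, \<beta>]\<close> (for
  instance, if the planar velocity is continuous and never vanishes).
\<close>

definition arclength_inverse ::
  "real \<Rightarrow> real \<Rightarrow> (real \<Rightarrow> real) \<Rightarrow> (real \<Rightarrow> real) \<Rightarrow> real \<Rightarrow> real" where
  "arclength_inverse \<alpha> \<beta> x y = the_inv_into {\<alpha>..\<beta>} (planar_arclength \<alpha> \<beta> x y)"

definition is_line_segment :: "(real \<times> real) set \<Rightarrow> bool" where
  "is_line_segment \<Gamma> \<longleftrightarrow> (\<exists>P Q. P \<noteq> Q \<and> \<Gamma> = closed_segment P Q)"

end

theory Submission imports Defs begin

text \<open>
  Both kinds of curves are governed by the evolution of their curvature, and the two evolution laws
  are incompatible unless the curvature is constant.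

  For an elastica the curvature is \<open>\<kappa> = \<theta>'\<close>. With \<open>A = p\<^sub>1 cos \<theta> + p\<^sub>2 sin \<theta>\<close> and
  \<open>\<kappa>' = B = p\<^sub>1 sin \<theta> - p\<^sub>2 cos \<theta>\<close>, the quantities \<open>A + \<kappa>\<^sup>2/2 = E\<close> (\<open>elastica_energy\<close>) and
  \<open>A\<^sup>2 + B\<^sup>2 = r\<close> are conserved, so
  \<open>(d\<kappa>/ds)\<^sup>2 = r - (E - \<kappa>\<^sup>2/2)\<^sup>2\<close>,
  a polynomial of degree four in \<open>\<kappa>\<close>.

  For a sub-Riemannian geodesic put \<open>w = q\<^sub>1 cos \<psi> + q\<^sub>2 sin \<psi>\<close> and
  \<open>v = q\<^sub>1 sin \<psi> - q\<^sub>2 cos \<psi>\<close>. The planar speed is \<open>\<bar>w\<bar>/\<xi>\<^sup>2\<close>, so the planar curvature is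
  \<open>\<kappa> = \<xi>\<^sup>2 q\<^sub>3/\<bar>w\<bar>\<close>. Conservation of \<open>\<rho> = w\<^sup>2 + v\<^sup>2\<close> (\<open>sr_lift_norm\<close>) and of the energy
  \<open>\<xi>\<^sup>2 w\<^sup>2 + (\<xi>\<^sup>2 q\<^sub>3)\<^sup>2 = w\<^sup>2 (\<xi>\<^sup>2 + \<kappa>\<^sup>2) = H\<close> (\<open>sr_energy\<close>), together with
  \<open>w d\<kappa>/ds = v (\<xi>\<^sup>2 + \<kappa>\<^sup>2)\<close> (\<open>curvature_relation\<close>), gives
  \<open>H (d\<kappa>/ds)\<^sup>2 = (\<rho> (\<xi>\<^sup>2 + \<kappa>\<^sup>2) - H) (\<xi>\<^sup>2 + \<kappa>\<^sup>2)\<^sup>2\<close>,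
  a polynomial of degree six whose leading coefficient \<open>\<rho>\<close> is nonzero because \<open>w \<noteq> 0\<close>.

  On an arc common to both curves, \<open>\<kappa>\<close> is therefore a root of a fixed nonzero polynomial
  (\<open>finite_common_curvatures\<close>); by continuity it is constant there. Then \<open>d\<kappa>/ds = 0\<close> forces first
  \<open>v = 0\<close>, then \<open>q\<^sub>3 w = v' = 0\<close>, hence \<open>q\<^sub>3 = 0\<close> and \<open>\<kappa> = 0\<close> (\<open>overlap_inflection\<close>). So each of the
  two extremals passes through an equilibrium of its own equation for the tangent angle. By
  uniqueness of solutions (\<open>coupled_linear_ode_zero\<close>) the angle is constant along the whole
  extremal, and both curves are straight (\<open>elastica_straight\<close>, \<open>sr_straight\<close>).

  The derivatives are compared in the parameter \<open>t\<close>, pulling the elastica back along the arclength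
  function \<open>\<phi>\<close>. In this way the inverse of \<open>\<phi>\<close> never has to be differentiated; of it only
  \<open>\<phi>\<^sup>-\<^sup>1(\<phi> t) = t\<close> is used.
\<close>

section \<open>Auxiliary facts from analysis\<close>

text \<open>
  A Gronwall argument: \<open>E = u\<^sup>2 + v\<^sup>2\<close> satisfies \<open>\<bar>E'\<bar> \<le> M E\<close>, so \<open>e\<^sup>-\<^sup>M\<^sup>t E\<close> decreases and
  \<open>e\<^sup>M\<^sup>t E\<close> increases. A zero of \<open>E\<close> therefore propagates in both directions. This is the
  uniqueness theorem that both curvature equations need: each makes the derivative of the angle and
  one momentum component into a pair of this form.
\<close>

lemma coupled_linear_ode_zero:
  fixes u v f g :: "real \<Rightarrow> real"
  assumes u: "\<And>t. t \<in> {a..b} \<Longrightarrow> (u has_real_derivative f t * v t) (at t within {a..b})"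
    and v: "\<And>t. t \<in> {a..b} \<Longrightarrow> (v has_real_derivative g t * u t) (at t within {a..b})"
    and cont: "continuous_on {a..b} f" "continuous_on {a..b} g"
    and z: "z \<in> {a..b}" "u z = 0" "v z = 0"
    and t: "t \<in> {a..b}"
  shows "u t = 0 \<and> v t = 0"
proof -
  have "continuous_on {a..b} (\<lambda>t. f t + g t)"
    using cont by (intro continuous_intros)
  then have "bounded ((\<lambda>t. f t + g t) ` {a..b})"
    by (intro compact_imp_bounded compact_continuous_image) auto
  then have "\<exists>M. \<forall>t\<in>{a..b}. \<bar>f t + g t\<bar> \<le> M"
    by (simp add: bounded_iff)
  then obtain M where M: "\<And>t. t \<in> {a..b} \<Longrightarrow> \<bar>f t + g t\<bar> \<le> M"
    by blast
  define E where "E = (\<lambda>t. (u t)\<^sup>2 + (v t)\<^sup>2)"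
  have E': "(E has_real_derivative 2 * (f t + g t) * (u t * v t)) (at t within {a..b})"
    if "t \<in> {a..b}" for t
    unfolding E_def using that
    by (auto intro!: derivative_eq_intros u v simp: algebra_simps)
  have growth: "\<bar>2 * (f t + g t) * (u t * v t)\<bar> \<le> M * E t" if "t \<in> {a..b}" for t
  proof -
    have "2 * \<bar>u t * v t\<bar> \<le> E t"
      using sum_squares_bound[of "\<bar>u t\<bar>" "\<bar>v t\<bar>"] by (simp add: E_def abs_mult)
    then have "\<bar>f t + g t\<bar> * (2 * \<bar>u t * v t\<bar>) \<le> M * E t"
      using M[OF that] by (intro mult_mono) auto
    moreover have "\<bar>2 * (f t + g t) * (u t * v t)\<bar> = \<bar>f t + g t\<bar> * (2 * \<bar>u t * v t\<bar>)"
      unfolding abs_mult by simp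
    ultimately show ?thesis by simp
  qed
  have at: "at s within {a..b} = at s" if "a < s" "s < b" for s
    using that by (simp add: at_within_Icc_at)
  have cont_E: "continuous_on {a..b} E"
    using E' by (meson DERIV_continuous continuous_on_eq_continuous_within)
  have "E t \<le> 0"
  proof (cases "z \<le> t")
    case True
    have "exp (- M * t) * E t \<le> exp (- M * z) * E z"
    proof (rule DERIV_nonpos_imp_decreasing_open[OF True])
      fix s assume s: "z < s" "s < t"
      then have ab: "a < s" "s < b" using t z by auto
      have "((\<lambda>t. exp (- M * t) * E t) has_real_derivative
              exp (- M * s) * (2 * (f s + g s) * (u s * v s) - M * E s)) (at s)"
        using E'[of s] ab by (auto intro!: derivative_eq_intros simp: at algebra_simps)
      moreover have "exp (- M * s) * (2 * (f s + g s) * (u s * v s) - M * E s) \<le> 0"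
        using growth[of s] ab by (intro mult_nonneg_nonpos) auto
      ultimately show "\<exists>y. ((\<lambda>t. exp (- M * t) * E t) has_real_derivative y) (at s) \<and> y \<le> 0"
        by blast
    next
      show "continuous_on {z..t} (\<lambda>t. exp (- M * t) * E t)"
        using t z by (intro continuous_intros continuous_on_subset[OF cont_E]) auto
    qed
    then show ?thesis by (simp add: E_def z mult_le_0_iff)
  next
    case False
    then have le: "t \<le> z" by simp
    have "exp (M * t) * E t \<le> exp (M * z) * E z"
    proof (rule DERIV_nonneg_imp_increasing_open[OF le])
      fix s assume s: "t < s" "s < z"
      then have ab: "a < s" "s < b" using t z by auto
      have "((\<lambda>t. exp (M * t) * E t) has_real_derivative
              exp (M * s) * (2 * (f s + g s) * (u s * v s) + M * E s)) (at s)"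
        using E'[of s] ab by (auto intro!: derivative_eq_intros simp: at algebra_simps)
      moreover have "exp (M * s) * (2 * (f s + g s) * (u s * v s) + M * E s) \<ge> 0"
        using growth[of s] ab by (intro mult_nonneg_nonneg) auto
      ultimately show "\<exists>y. ((\<lambda>t. exp (M * t) * E t) has_real_derivative y) (at s) \<and> 0 \<le> y"
        by blast
    next
      show "continuous_on {t..z} (\<lambda>t. exp (M * t) * E t)"
        using t z by (intro continuous_intros continuous_on_subset[OF cont_E]) auto
    qed
    then show ?thesis by (simp add: E_def z mult_le_0_iff)
  qed
  then show ?thesis
    by (simp add: E_def sum_power2_le_zero_iff)
qed

lemma finite_roots_even_sextic:
  fixes c0 c2 c4 c6 :: real
  assumes "c6 \<noteq> 0"
  shows "finite {k. c0 + c2 * k^2 + c4 * k^4 + c6 * k^6 = 0}"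
proof -
  have "finite {k. poly [:c0, 0, c2, 0, c4, 0, c6:] k = 0}"
    using assms by (intro poly_roots_finite) simp
  moreover have "poly [:c0, 0, c2, 0, c4, 0, c6:] k = c0 + c2 * k^2 + c4 * k^4 + c6 * k^6" for k
    by (simp add: algebra_simps power_numeral_reduce)
  ultimately show ?thesis by (simp only:)
qed

lemma is_line_segment_uniform_motion:
  fixes x y :: "real \<Rightarrow> real"
  assumes "a < b" and "u \<noteq> 0 \<or> v \<noteq> 0"
    and x: "\<And>t. t \<in> {a..b} \<Longrightarrow> (x has_real_derivative u) (at t within {a..b})"
    and y: "\<And>t. t \<in> {a..b} \<Longrightarrow> (y has_real_derivative v) (at t within {a..b})"
  shows "is_line_segment ((\<lambda>t. (x t, y t)) ` {a..b})"
proof -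
  have affine: "f t = f a + (t - a) * m"
    if f: "\<And>t. t \<in> {a..b} \<Longrightarrow> (f has_real_derivative m) (at t within {a..b})"
      and t: "t \<in> {a..b}" for f m t
  proof -
    have "\<exists>c. \<forall>t\<in>{a..b}. f t - t * m = c"
      by (intro has_field_derivative_zero_constant) (auto intro!: derivative_eq_intros f)
    then obtain c where "\<forall>t\<in>{a..b}. f t - t * m = c" by blast
    then have "f t - t * m = f a - a * m" using t by simp
    then show ?thesis by (simp add: algebra_simps)
  qed
  define h where "h = (\<lambda>r. r *\<^sub>R (u, v))"
  have "linear h" unfolding h_def by (intro linear_scale_self linearI) (simp_all add: algebra_simps)
  have "(\<lambda>t. (x t, y t)) ` {a..b} = (\<lambda>t. (x a - a * u, y a - a * v) + h t) ` {a..b}"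
    using affine[OF x] affine[OF y] by (intro image_cong) (auto simp: h_def algebra_simps)
  also have "\<dots> = (+) (x a - a * u, y a - a * v) ` h ` closed_segment a b"
    using \<open>a < b\<close> by (simp add: closed_segment_eq_real_ivl image_image)
  also have "\<dots> = closed_segment ((x a - a * u, y a - a * v) + h a) ((x a - a * u, y a - a * v) + h b)"
    by (simp only: closed_segment_linear_image[OF \<open>linear h\<close>, symmetric] closed_segment_translation)
  finally have "(\<lambda>t. (x t, y t)) ` {a..b} = \<dots>" .
  moreover have "(x a - a * u, y a - a * v) + h a \<noteq> (x a - a * u, y a - a * v) + h b"
    using assms(1,2) by (auto simp: h_def)
  ultimately show ?thesis unfolding is_line_segment_def by blast
qed

section \<open>Elasticae\<close>

text \<open>
  The extremal system with its two cyclic momenta replaced by constants and the third momentum, which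
  is the curvature, called \<open>\<kappa>\<close>.
\<close>

definition elastica_lift ::
  "real \<Rightarrow> real \<Rightarrow> real \<Rightarrow> real \<Rightarrow> (real \<Rightarrow> real) \<Rightarrow> (real \<Rightarrow> real) \<Rightarrow> (real \<Rightarrow> real) \<Rightarrow> (real \<Rightarrow> real) \<Rightarrow> bool"
where
  "elastica_lift a b p\<^sub>1 p\<^sub>2 x y \<theta> \<kappa> \<longleftrightarrow> (\<forall>s\<in>{a..b}.
     (\<kappa> has_real_derivative p\<^sub>1 * sin (\<theta> s) - p\<^sub>2 * cos (\<theta> s)) (at s within {a..b}) \<and>
     (x has_real_derivative cos (\<theta> s)) (at s within {a..b}) \<and>
     (y has_real_derivative sin (\<theta> s)) (at s within {a..b}) \<and>
     (\<theta> has_real_derivative \<kappa> s) (at s within {a..b}))"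

lemma elastica_lift_exists:
  assumes "elastica a b x y"
  obtains p\<^sub>1 p\<^sub>2 \<theta> \<kappa> where "elastica_lift a b p\<^sub>1 p\<^sub>2 x y \<theta> \<kappa>"
proof -
  obtain \<theta> p\<^sub>1 p\<^sub>2 p\<^sub>3 where H: "\<And>s. s \<in> {a..b} \<Longrightarrow>
       (p\<^sub>1 has_real_derivative 0) (at s within {a..b}) \<and>
       (p\<^sub>2 has_real_derivative 0) (at s within {a..b}) \<and>
       (p\<^sub>3 has_real_derivative p\<^sub>1 s * sin (\<theta> s) - p\<^sub>2 s * cos (\<theta> s)) (at s within {a..b}) \<and>
       (x has_real_derivative cos (\<theta> s)) (at s within {a..b}) \<and>
       (y has_real_derivative sin (\<theta> s)) (at s within {a..b}) \<and>
       (\<theta> has_real_derivative p\<^sub>3 s) (at s within {a..b})"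
    using assms unfolding elastica_def by blast
  obtain c\<^sub>1 where c1: "\<And>s. s \<in> {a..b} \<Longrightarrow> p\<^sub>1 s = c\<^sub>1"
    using has_field_derivative_zero_constant[of "{a..b}" p\<^sub>1] H by auto
  obtain c\<^sub>2 where c2: "\<And>s. s \<in> {a..b} \<Longrightarrow> p\<^sub>2 s = c\<^sub>2"
    using has_field_derivative_zero_constant[of "{a..b}" p\<^sub>2] H by auto
  have "elastica_lift a b c\<^sub>1 c\<^sub>2 x y \<theta> p\<^sub>3"
    unfolding elastica_lift_def
  proof
    fix s assume s: "s \<in> {a..b}"
    show "(p\<^sub>3 has_real_derivative c\<^sub>1 * sin (\<theta> s) - c\<^sub>2 * cos (\<theta> s)) (at s within {a..b}) \<and>
       (x has_real_derivative cos (\<theta> s)) (at s within {a..b}) \<and>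
       (y has_real_derivative sin (\<theta> s)) (at s within {a..b}) \<and>
       (\<theta> has_real_derivative p\<^sub>3 s) (at s within {a..b})"
      using H[OF s] c1[OF s] c2[OF s] by simp
  qed
  then show thesis by (rule that)
qed

text \<open>
  This is the Hamiltonian of the elastica problem. It expresses the component of the momentum along
  the tangent through the curvature, and so makes \<open>(\<kappa>')\<^sup>2\<close> a polynomial in \<open>\<kappa>\<close>.
\<close>

lemma elastica_energy:
  assumes "elastica_lift a b p\<^sub>1 p\<^sub>2 x y \<theta> \<kappa>"
  obtains E where "\<And>s. s \<in> {a..b} \<Longrightarrow> p\<^sub>1 * cos (\<theta> s) + p\<^sub>2 * sin (\<theta> s) = E - (\<kappa> s)\<^sup>2 / 2"
proof -
  note D = assms[unfolded elastica_lift_def, rule_format]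
  have "\<exists>E. \<forall>s\<in>{a..b}. p\<^sub>1 * cos (\<theta> s) + p\<^sub>2 * sin (\<theta> s) + (\<kappa> s)\<^sup>2 / 2 = E"
  proof (rule has_field_derivative_zero_constant)
    fix s assume s: "s \<in> {a..b}"
    show "((\<lambda>s. p\<^sub>1 * cos (\<theta> s) + p\<^sub>2 * sin (\<theta> s) + (\<kappa> s)\<^sup>2 / 2) has_real_derivative 0)
        (at s within {a..b})"
      using D[OF s] by (auto intro!: derivative_eq_intros simp: field_simps)
  qed simp
  then show thesis using that by (metis add_diff_cancel_right')
qed

text \<open>
  An inflection point where the curvature is also stationary is an equilibrium of the pendulum
  equation for \<open>\<theta>\<close>: the pair \<open>\<kappa>' = B\<close>, \<open>B' = A \<kappa>\<close> is linear with coefficients \<open>1\<close> and \<open>A\<close> that are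
  continuous along the curve.
\<close>

lemma elastica_straight:
  assumes lift: "elastica_lift a b p\<^sub>1 p\<^sub>2 x y \<theta> \<kappa>" and "a < b"
    and s0: "s0 \<in> {a..b}" "\<kappa> s0 = 0" "p\<^sub>1 * sin (\<theta> s0) - p\<^sub>2 * cos (\<theta> s0) = 0"
  shows "is_line_segment ((\<lambda>s. (x s, y s)) ` {a..b})"
proof -
  note D = lift[unfolded elastica_lift_def, rule_format]
  have cont: "continuous_on {a..b} \<theta>"
    using D by (meson DERIV_continuous continuous_on_eq_continuous_within)
  have \<kappa>0: "\<kappa> s = 0" if "s \<in> {a..b}" for s
  proof -
    have "\<kappa> s = 0 \<and> p\<^sub>1 * sin (\<theta> s) - p\<^sub>2 * cos (\<theta> s) = 0"
    proof (rule coupled_linear_ode_zero[where u = \<kappa> and f = "\<lambda>_. 1" and z = s0 and a = a and b = b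
          and v = "\<lambda>s. p\<^sub>1 * sin (\<theta> s) - p\<^sub>2 * cos (\<theta> s)"
          and g = "\<lambda>s. p\<^sub>1 * cos (\<theta> s) + p\<^sub>2 * sin (\<theta> s)"])
      fix t assume "t \<in> {a..b}"
      then show "((\<lambda>s. p\<^sub>1 * sin (\<theta> s) - p\<^sub>2 * cos (\<theta> s)) has_real_derivative
          (p\<^sub>1 * cos (\<theta> t) + p\<^sub>2 * sin (\<theta> t)) * \<kappa> t) (at t within {a..b})"
        using D[of t] by (auto intro!: derivative_eq_intros simp: algebra_simps)
    qed (use D s0 that cont in \<open>auto intro!: continuous_intros\<close>)
    then show ?thesis ..
  qed
  obtain \<theta>0 where \<theta>0: "\<And>s. s \<in> {a..b} \<Longrightarrow> \<theta> s = \<theta>0"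
    using has_field_derivative_zero_constant[of "{a..b}" \<theta>] D \<kappa>0 by auto
  show ?thesis
  proof (rule is_line_segment_uniform_motion[where u = "cos \<theta>0" and v = "sin \<theta>0"])
    show "cos \<theta>0 \<noteq> 0 \<or> sin \<theta>0 \<noteq> 0"
      using sin_cos_squared_add[of \<theta>0] by fastforce
  qed (use D \<theta>0 \<open>a < b\<close> in force)+
qed

section \<open>Sub-Riemannian geodesics\<close>

text \<open>
  Here \<open>w\<close> and \<open>v\<close> are the components of the constant planar momentum \<open>(q\<^sub>1, q\<^sub>2)\<close> along the heading
  \<open>(cos \<psi>, sin \<psi>)\<close> and along its clockwise normal \<open>(sin \<psi>, - cos \<psi>)\<close>. They are arguments so that
  statements can treat them as functions in their own right, solving an autonomous system together
  with \<open>q\<^sub>3\<close>.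
\<close>

definition sr_lift ::
  "real \<Rightarrow> real \<Rightarrow> real \<Rightarrow> real \<Rightarrow> real \<Rightarrow> (real \<Rightarrow> real) \<Rightarrow> (real \<Rightarrow> real) \<Rightarrow> (real \<Rightarrow> real) \<Rightarrow>
   (real \<Rightarrow> real) \<Rightarrow> (real \<Rightarrow> real) \<Rightarrow> (real \<Rightarrow> real) \<Rightarrow> bool"
where
  "sr_lift \<xi> \<alpha> \<beta> q\<^sub>1 q\<^sub>2 x y \<psi> q\<^sub>3 w v \<longleftrightarrow>
     w = (\<lambda>t. q\<^sub>1 * cos (\<psi> t) + q\<^sub>2 * sin (\<psi> t)) \<and>
     v = (\<lambda>t. q\<^sub>1 * sin (\<psi> t) - q\<^sub>2 * cos (\<psi> t)) \<and>
     (\<forall>t\<in>{\<alpha>..\<beta>}.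
       (q\<^sub>3 has_real_derivative w t * v t / \<xi>\<^sup>2) (at t within {\<alpha>..\<beta>}) \<and>
       (x has_real_derivative w t / \<xi>\<^sup>2 * cos (\<psi> t)) (at t within {\<alpha>..\<beta>}) \<and>
       (y has_real_derivative w t / \<xi>\<^sup>2 * sin (\<psi> t)) (at t within {\<alpha>..\<beta>}) \<and>
       (\<psi> has_real_derivative q\<^sub>3 t) (at t within {\<alpha>..\<beta>}))"

lemma sr_lift_exists:
  assumes "sr_geodesic \<xi> \<alpha> \<beta> x y \<psi>"
  obtains q\<^sub>1 q\<^sub>2 q\<^sub>3 w v where "sr_lift \<xi> \<alpha> \<beta> q\<^sub>1 q\<^sub>2 x y \<psi> q\<^sub>3 w v"
proof -
  obtain p\<^sub>1 p\<^sub>2 p\<^sub>3 where H: "\<And>t. t \<in> {\<alpha>..\<beta>} \<Longrightarrow>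
       (p\<^sub>1 has_real_derivative 0) (at t within {\<alpha>..\<beta>}) \<and>
       (p\<^sub>2 has_real_derivative 0) (at t within {\<alpha>..\<beta>}) \<and>
       (p\<^sub>3 has_real_derivative (p\<^sub>1 t * cos (\<psi> t) + p\<^sub>2 t * sin (\<psi> t)) *
           (p\<^sub>1 t * sin (\<psi> t) - p\<^sub>2 t * cos (\<psi> t)) / \<xi>\<^sup>2) (at t within {\<alpha>..\<beta>}) \<and>
       (x has_real_derivative (p\<^sub>1 t * cos (\<psi> t) + p\<^sub>2 t * sin (\<psi> t)) / \<xi>\<^sup>2 * cos (\<psi> t))
         (at t within {\<alpha>..\<beta>}) \<and>
       (y has_real_derivative (p\<^sub>1 t * cos (\<psi> t) + p\<^sub>2 t * sin (\<psi> t)) / \<xi>\<^sup>2 * sin (\<psi> t))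
         (at t within {\<alpha>..\<beta>}) \<and>
       (\<psi> has_real_derivative p\<^sub>3 t) (at t within {\<alpha>..\<beta>})"
    using assms unfolding sr_geodesic_def Let_def by blast
  obtain c\<^sub>1 where c1: "\<And>s. s \<in> {\<alpha>..\<beta>} \<Longrightarrow> p\<^sub>1 s = c\<^sub>1"
    using has_field_derivative_zero_constant[of "{\<alpha>..\<beta>}" p\<^sub>1] H by auto
  obtain c\<^sub>2 where c2: "\<And>s. s \<in> {\<alpha>..\<beta>} \<Longrightarrow> p\<^sub>2 s = c\<^sub>2"
    using has_field_derivative_zero_constant[of "{\<alpha>..\<beta>}" p\<^sub>2] H by auto
  have "sr_lift \<xi> \<alpha> \<beta> c\<^sub>1 c\<^sub>2 x y \<psi> p\<^sub>3
      (\<lambda>t. c\<^sub>1 * cos (\<psi> t) + c\<^sub>2 * sin (\<psi> t)) (\<lambda>t. c\<^sub>1 * sin (\<psi> t) - c\<^sub>2 * cos (\<psi> t))"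
    unfolding sr_lift_def using H c1 c2 by simp
  then show thesis by (rule that)
qed

lemma sr_lift_derivs:
  assumes lift: "sr_lift \<xi> \<alpha> \<beta> q\<^sub>1 q\<^sub>2 x y \<psi> q\<^sub>3 w v" and t: "t \<in> {\<alpha>..\<beta>}"
  shows "(q\<^sub>3 has_real_derivative w t * v t / \<xi>\<^sup>2) (at t within {\<alpha>..\<beta>})"
    and "(x has_real_derivative w t / \<xi>\<^sup>2 * cos (\<psi> t)) (at t within {\<alpha>..\<beta>})"
    and "(y has_real_derivative w t / \<xi>\<^sup>2 * sin (\<psi> t)) (at t within {\<alpha>..\<beta>})"
    and "(\<psi> has_real_derivative q\<^sub>3 t) (at t within {\<alpha>..\<beta>})"
    and "(w has_real_derivative - (q\<^sub>3 t * v t)) (at t within {\<alpha>..\<beta>})"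
    and "(v has_real_derivative q\<^sub>3 t * w t) (at t within {\<alpha>..\<beta>})"
proof -
  show \<psi>: "(\<psi> has_real_derivative q\<^sub>3 t) (at t within {\<alpha>..\<beta>})"
    using assms by (simp add: sr_lift_def)
  have w: "w = (\<lambda>t. q\<^sub>1 * cos (\<psi> t) + q\<^sub>2 * sin (\<psi> t))"
    and v: "v = (\<lambda>t. q\<^sub>1 * sin (\<psi> t) - q\<^sub>2 * cos (\<psi> t))"
    using lift by (simp_all add: sr_lift_def)
  show "(w has_real_derivative - (q\<^sub>3 t * v t)) (at t within {\<alpha>..\<beta>})"
    unfolding w v by (auto intro!: derivative_eq_intros \<psi> simp: algebra_simps)
  show "(v has_real_derivative q\<^sub>3 t * w t) (at t within {\<alpha>..\<beta>})"
    unfolding w v by (auto intro!: derivative_eq_intros \<psi> simp: algebra_simps)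
qed (use assms in \<open>unfold sr_lift_def, blast\<close>)+

lemma sr_lift_norm:
  assumes "sr_lift \<xi> \<alpha> \<beta> q\<^sub>1 q\<^sub>2 x y \<psi> q\<^sub>3 w v"
  shows "(w t)\<^sup>2 + (v t)\<^sup>2 = q\<^sub>1\<^sup>2 + q\<^sub>2\<^sup>2"
proof -
  have wv: "w t = q\<^sub>1 * cos (\<psi> t) + q\<^sub>2 * sin (\<psi> t)" "v t = q\<^sub>1 * sin (\<psi> t) - q\<^sub>2 * cos (\<psi> t)"
    using assms by (auto simp: sr_lift_def)
  have "(w t)\<^sup>2 + (v t)\<^sup>2 = (q\<^sub>1\<^sup>2 + q\<^sub>2\<^sup>2) * ((sin (\<psi> t))\<^sup>2 + (cos (\<psi> t))\<^sup>2)"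
    unfolding wv by algebra
  then show ?thesis by simp
qed

text \<open>
  Up to the factor \<open>2\<xi>\<^sup>4\<close> this is the sub-Riemannian Hamiltonian; with this scaling, substituting
  \<open>\<xi>\<^sup>2 q\<^sub>3 = \<kappa> \<bar>w\<bar>\<close> leaves \<open>w\<^sup>2 (\<xi>\<^sup>2 + \<kappa>\<^sup>2)\<close>.
\<close>

lemma sr_energy:
  assumes lift: "sr_lift \<xi> \<alpha> \<beta> q\<^sub>1 q\<^sub>2 x y \<psi> q\<^sub>3 w v" and "\<xi> > 0"
  obtains H where "\<And>t. t \<in> {\<alpha>..\<beta>} \<Longrightarrow> \<xi>\<^sup>2 * (w t)\<^sup>2 + (\<xi>\<^sup>2 * q\<^sub>3 t)\<^sup>2 = H"
proof -
  have "\<exists>H. \<forall>t\<in>{\<alpha>..\<beta>}. \<xi>\<^sup>2 * (w t)\<^sup>2 + (\<xi>\<^sup>2 * q\<^sub>3 t)\<^sup>2 = H"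
  proof (rule has_field_derivative_zero_constant)
    fix t assume t: "t \<in> {\<alpha>..\<beta>}"
    note D = sr_lift_derivs[OF lift t]
    show "((\<lambda>t. \<xi>\<^sup>2 * (w t)\<^sup>2 + (\<xi>\<^sup>2 * q\<^sub>3 t)\<^sup>2) has_real_derivative 0) (at t within {\<alpha>..\<beta>})"
      by (rule derivative_eq_intros D refl)+
         (use \<open>\<xi> > 0\<close> in \<open>simp add: field_simps power2_eq_square\<close>)
  qed simp
  then show thesis using that by blast
qed

text \<open>
  As for elasticae: \<open>q\<^sub>3' = (w/\<xi>\<^sup>2) v\<close> and \<open>v' = w q\<^sub>3\<close> form a linear pair. Once \<open>\<psi>\<close> is constant, so is
  \<open>w\<close>, and its being nonzero keeps the motion from degenerating to a point.
\<close>

lemma sr_straight: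
  assumes lift: "sr_lift \<xi> \<alpha> \<beta> q\<^sub>1 q\<^sub>2 x y \<psi> q\<^sub>3 w v" and "\<xi> > 0" "\<alpha> < \<beta>"
    and t0: "t0 \<in> {\<alpha>..\<beta>}" "q\<^sub>3 t0 = 0" "v t0 = 0" "w t0 \<noteq> 0"
  shows "is_line_segment ((\<lambda>t. (x t, y t)) ` {\<alpha>..\<beta>})"
proof -
  note D = sr_lift_derivs[OF lift]
  have cont: "continuous_on {\<alpha>..\<beta>} w"
    using D(5) by (meson DERIV_continuous continuous_on_eq_continuous_within)
  have q0: "q\<^sub>3 t = 0" if "t \<in> {\<alpha>..\<beta>}" for t
  proof -
    have "q\<^sub>3 t = 0 \<and> v t = 0"
    proof (rule coupled_linear_ode_zero[where u = q\<^sub>3 and v = v and f = "\<lambda>t. w t / \<xi>\<^sup>2" and z = t0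
          and a = \<alpha> and b = \<beta> and g = w])
      show "continuous_on {\<alpha>..\<beta>} (\<lambda>t. w t / \<xi>\<^sup>2)"
        using cont \<open>\<xi> > 0\<close> by (auto intro!: continuous_intros)
    qed (use D(1,6) t0 that cont in \<open>auto simp: mult.commute\<close>)
    then show ?thesis ..
  qed
  obtain \<psi>0 where "\<forall>t\<in>{\<alpha>..\<beta>}. \<psi> t = \<psi>0"
    using has_field_derivative_zero_constant[of "{\<alpha>..\<beta>}" \<psi>] D(4) q0 by auto
  then have \<psi>0: "\<psi> t = \<psi> t0" "w t = w t0" if "t \<in> {\<alpha>..\<beta>}" for t
    using that t0(1) lift by (simp_all add: sr_lift_def)
  show ?thesis
  proof (rule is_line_segment_uniform_motion)
    show "w t0 / \<xi>\<^sup>2 * cos (\<psi> t0) \<noteq> 0 \<or> w t0 / \<xi>\<^sup>2 * sin (\<psi> t0) \<noteq> 0"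
      using sin_cos_squared_add[of "\<psi> t0"] t0(4) \<open>\<xi> > 0\<close>
      by (auto simp del: sin_cos_squared_add)
    fix t assume t: "t \<in> {\<alpha>..\<beta>}"
    show "(x has_real_derivative w t0 / \<xi>\<^sup>2 * cos (\<psi> t0)) (at t within {\<alpha>..\<beta>})"
      using D(2)[OF t] by (simp only: \<psi>0[OF t])
    show "(y has_real_derivative w t0 / \<xi>\<^sup>2 * sin (\<psi> t0)) (at t within {\<alpha>..\<beta>})"
      using D(3)[OF t] by (simp only: \<psi>0[OF t])
  qed fact
qed

lemma sr_planar_speed:
  assumes lift: "sr_lift \<xi> \<alpha> \<beta> q\<^sub>1 q\<^sub>2 x y \<psi> q\<^sub>3 w v" and "\<alpha> < \<beta>" and t: "t \<in> {\<alpha>..\<beta>}"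
  shows "planar_speed \<alpha> \<beta> x y t = \<bar>w t\<bar> / \<xi>\<^sup>2"
proof -
  have vd: "vector_derivative f (at t within {\<alpha>..\<beta>}) = m"
    if "(f has_real_derivative m) (at t within {\<alpha>..\<beta>})" for f m
    using vector_derivative_within_cbox[of \<alpha> \<beta> t f m] that \<open>\<alpha> < \<beta>\<close> t
    by (simp add: has_real_derivative_iff_has_vector_derivative)
  have "(w t / \<xi>\<^sup>2 * cos (\<psi> t))\<^sup>2 + (w t / \<xi>\<^sup>2 * sin (\<psi> t))\<^sup>2
      = (w t / \<xi>\<^sup>2)\<^sup>2 * ((sin (\<psi> t))\<^sup>2 + (cos (\<psi> t))\<^sup>2)"
    by algebra
  then show ?thesis
    by (simp add: planar_speed_def vd[OF sr_lift_derivs(2)[OF lift t]]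
        vd[OF sr_lift_derivs(3)[OF lift t]] abs_divide)
qed

text \<open>
  The sign of \<open>w\<close> decides whether the planar curve is run along the heading \<open>\<psi>\<close> or backwards. It is
  kept as a number \<open>\<sigma>\<close> so that both cases are handled by the same algebra.
\<close>

lemma continuous_nonzero_sign:
  fixes w :: "real \<Rightarrow> real"
  assumes "continuous_on {\<alpha>..\<beta>} w" and "\<And>t. t \<in> {\<alpha>..\<beta>} \<Longrightarrow> w t \<noteq> 0"
  obtains \<sigma> :: real where "\<sigma>\<^sup>2 = 1" and "\<And>t. t \<in> {\<alpha>..\<beta>} \<Longrightarrow> \<sigma> * w t = \<bar>w t\<bar>"
proof -
  have conn: "is_interval (w ` {\<alpha>..\<beta>})"
    using assms(1) by (simp add: connected_continuous_image is_interval_connected_1)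
  have "(\<forall>t\<in>{\<alpha>..\<beta>}. w t > 0) \<or> (\<forall>t\<in>{\<alpha>..\<beta>}. w t < 0)"
  proof (rule ccontr)
    assume "\<not> ?thesis"
    then obtain s t where "s \<in> {\<alpha>..\<beta>}" "w s \<le> 0" "t \<in> {\<alpha>..\<beta>}" "w t \<ge> 0"
      by (auto simp: not_less)
    then have "0 \<in> w ` {\<alpha>..\<beta>}"
      using mem_is_interval_1_I[OF conn, of "w s" "w t" 0] by auto
    then show False using assms(2) by auto
  qed
  then show thesis
    using that[of 1] that[of "-1"] by fastforce
qed

section \<open>Comparing curvatures\<close>

lemma derivative_unique_open:
  fixes f g :: "real \<Rightarrow> real"
  assumes "open J" "t \<in> J" "\<And>s. s \<in> J \<Longrightarrow> f s = g s"
    and "(f has_real_derivative m) (at t)" "(g has_real_derivative n) (at t)"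
  shows "m = n"
proof -
  have "(g has_real_derivative m) (at t)"
    using assms(1-4) by (blast intro: has_field_derivative_transform_within_open)
  then show ?thesis using assms(5) by (rule DERIV_unique)
qed

text \<open>
  The tangent angles \<open>\<theta>\<close> and \<open>\<psi>\<close> of a common arc agree up to multiples of \<open>\<pi>\<close>, which is expressed
  through the cosine and sine since the lifts themselves may differ. Differentiating these
  identities along \<open>\<phi>\<close> yields the first relation, between the curvatures; differentiating that one
  yields the second, between the derivatives of the curvatures.
\<close>

lemma curvature_relation:
  fixes \<theta> \<kappa> \<psi> q\<^sub>3 w v \<phi> :: "real \<Rightarrow> real"
  assumes "\<xi> > 0" and \<sigma>: "\<sigma>\<^sup>2 = 1" and I: "open I" "open J"
    and \<phi>: "\<And>t. t \<in> J \<Longrightarrow> \<phi> t \<in> I \<and> (\<phi> has_real_derivative \<sigma> * w t / \<xi>\<^sup>2) (at t)"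
    and \<theta>: "\<And>s. s \<in> I \<Longrightarrow> (\<theta> has_real_derivative \<kappa> s) (at s)"
    and \<kappa>: "\<And>s. s \<in> I \<Longrightarrow> (\<kappa> has_real_derivative B s) (at s)"
    and \<psi>: "\<And>t. t \<in> J \<Longrightarrow> (\<psi> has_real_derivative q\<^sub>3 t) (at t)"
    and q: "\<And>t. t \<in> J \<Longrightarrow> (q\<^sub>3 has_real_derivative w t * v t / \<xi>\<^sup>2) (at t)"
    and w: "\<And>t. t \<in> J \<Longrightarrow> (w has_real_derivative - (q\<^sub>3 t * v t)) (at t)"
    and w0: "\<And>t. t \<in> J \<Longrightarrow> w t \<noteq> 0"
    and cos: "\<And>t. t \<in> J \<Longrightarrow> cos (\<theta> (\<phi> t)) = \<sigma> * cos (\<psi> t)"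
    and sin: "\<And>t. t \<in> J \<Longrightarrow> sin (\<theta> (\<phi> t)) = \<sigma> * sin (\<psi> t)"
    and t: "t \<in> J"
  shows "\<kappa> (\<phi> t) * (\<sigma> * w t) = \<xi>\<^sup>2 * q\<^sub>3 t" (is ?curv)
    and "B (\<phi> t) * w t = v t * (\<xi>\<^sup>2 + (\<kappa> (\<phi> t))\<^sup>2)" (is ?curv')
proof -
  note uniq = derivative_unique_open[OF I(2)]
  have chain: "((\<lambda>t. f (\<phi> t)) has_real_derivative m * (\<sigma> * w t / \<xi>\<^sup>2)) (at t)"
    if "t \<in> J" "(f has_real_derivative m) (at (\<phi> t))" for f m t
    using DERIV_chain2[of f m \<phi> t] that(2) \<phi>[OF that(1)] by blast
  have curv: "\<kappa> (\<phi> t) * (\<sigma> * w t) = \<xi>\<^sup>2 * q\<^sub>3 t" if t: "t \<in> J" for t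
  proof -
    note ch = chain[OF t \<theta>[of "\<phi> t"]]
    have I: "\<phi> t \<in> I" using \<phi>[OF t] ..
    have c: "- sin (\<theta> (\<phi> t)) * (\<kappa> (\<phi> t) * (\<sigma> * w t / \<xi>\<^sup>2)) = \<sigma> * (- sin (\<psi> t) * q\<^sub>3 t)"
      by (rule uniq[OF t cos]) (auto intro!: derivative_eq_intros ch \<psi> I t)
    have s: "cos (\<theta> (\<phi> t)) * (\<kappa> (\<phi> t) * (\<sigma> * w t / \<xi>\<^sup>2)) = \<sigma> * (cos (\<psi> t) * q\<^sub>3 t)"
      by (rule uniq[OF t sin]) (auto intro!: derivative_eq_intros ch \<psi> I t)
    have one: "(sin (\<psi> t))\<^sup>2 + (cos (\<psi> t))\<^sup>2 = 1" by simp
    \<comment> \<open>Either trigonometric factor may vanish; weighting the two equations by \<open>sin \<psi>\<close> and \<open>cos \<psi>\<close> and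
      adding them avoids dividing by one of them.\<close>
    have "\<kappa> (\<phi> t) * (\<sigma> * w t / \<xi>\<^sup>2) = q\<^sub>3 t"
      using c s one \<sigma> unfolding cos[OF t] sin[OF t] by algebra
    then show ?thesis using \<open>\<xi> > 0\<close> by (simp add: field_simps)
  qed
  then show ?curv using t .
  have I: "\<phi> t \<in> I" using \<phi>[OF t] ..
  \<comment> \<open>The derivative of both sides of the relation between the curvatures.\<close>
  have "\<kappa> (\<phi> t) * (\<sigma> * - (q\<^sub>3 t * v t)) + B (\<phi> t) * (\<sigma> * w t / \<xi>\<^sup>2) * (\<sigma> * w t)
      = \<xi>\<^sup>2 * (w t * v t / \<xi>\<^sup>2)"
    by (rule uniq[OF t curv]) (auto intro!: derivative_eq_intros chain[OF t \<kappa>[OF I]] w q t)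
  then have "\<sigma>\<^sup>2 * (B (\<phi> t) * (w t)\<^sup>2)
      = \<xi>\<^sup>2 * (w t * v t) + \<kappa> (\<phi> t) * \<sigma> * v t * (\<xi>\<^sup>2 * q\<^sub>3 t)"
    using \<open>\<xi> > 0\<close> by (simp add: field_simps power2_eq_square)
  then have *: "B (\<phi> t) * (w t)\<^sup>2
      = \<xi>\<^sup>2 * (w t * v t) + \<kappa> (\<phi> t) * \<sigma> * v t * (\<xi>\<^sup>2 * q\<^sub>3 t)"
    using \<sigma> by simp
  have "w t * (B (\<phi> t) * w t) = w t * (v t * (\<xi>\<^sup>2 + (\<kappa> (\<phi> t))\<^sup>2))"
    using * curv[OF t, symmetric] \<sigma> by algebra
  then show ?curv' using w0[OF t] by simp
qed


text \<open>
  The left-hand side, from the elastica, has degree four in \<open>k\<close>, and the right-hand side, from the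
  sub-Riemannian geodesic, has degree six with leading coefficient \<open>\<rho>\<close>, so they differ as
  polynomials whatever the conserved quantities \<open>r, E, H\<close> are.
\<close>

lemma finite_common_curvatures:
  fixes r E H \<rho> :: real
  assumes "\<rho> \<noteq> 0"
  shows "finite {k. H * (r - (E - k\<^sup>2 / 2)\<^sup>2) = (\<rho> * (\<xi>\<^sup>2 + k\<^sup>2) - H) * (\<xi>\<^sup>2 + k\<^sup>2)\<^sup>2}"
proof -
  let ?c0 = "H * (r - E\<^sup>2) - (\<rho> * \<xi>\<^sup>2 - H) * \<xi>^4"
  let ?c2 = "H * E - \<rho> * \<xi>^4 - 2 * \<xi>\<^sup>2 * (\<rho> * \<xi>\<^sup>2 - H)"
  let ?c4 = "- H / 4 - 2 * \<rho> * \<xi>\<^sup>2 - (\<rho> * \<xi>\<^sup>2 - H)"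
  have "?c0 + ?c2 * k^2 + ?c4 * k^4 + (- \<rho>) * k^6 =
      H * (r - (E - k\<^sup>2 / 2)\<^sup>2) - (\<rho> * (\<xi>\<^sup>2 + k\<^sup>2) - H) * (\<xi>\<^sup>2 + k\<^sup>2)\<^sup>2" for k
    by (simp add: field_simps power_numeral_reduce)
  moreover have "finite {k. ?c0 + ?c2 * k^2 + ?c4 * k^4 + (- \<rho>) * k^6 = 0}"
    using assms by (intro finite_roots_even_sextic) simp
  ultimately show ?thesis by simp
qed

text \<open>
  On a common arc both extremals are in equilibrium, because the two polynomial laws for the curvature
  leave it only finitely many values. The map \<open>\<phi>\<close> stands for the arclength function of the geodesic:
  with \<open>\<sigma>\<close> the sign of \<open>w\<close>, its derivative \<open>\<sigma> w/\<xi>\<^sup>2\<close> is the planar speed.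
\<close>

lemma overlap_inflection:
  fixes \<phi> :: "real \<Rightarrow> real"
  assumes el: "elastica_lift a b p\<^sub>1 p\<^sub>2 x y \<theta> \<kappa>"
    and sr: "sr_lift \<xi> \<alpha> \<beta> q\<^sub>1 q\<^sub>2 x' y' \<psi> q\<^sub>3 w v"
    and "\<xi> > 0" and \<sigma>: "\<sigma>\<^sup>2 = 1"
    and w0: "\<And>t. t \<in> {\<alpha>..\<beta>} \<Longrightarrow> w t \<noteq> 0"
    and "t\<^sub>1 < t\<^sub>2" and J: "{t\<^sub>1<..<t\<^sub>2} \<subseteq> {\<alpha><..<\<beta>}" and I: "open I" "I \<subseteq> {a<..<b}"
    and \<phi>: "\<And>t. t \<in> {t\<^sub>1<..<t\<^sub>2} \<Longrightarrow> \<phi> t \<in> I \<and> (\<phi> has_real_derivative \<sigma> * w t / \<xi>\<^sup>2) (at t)"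
    and xy: "\<And>t. t \<in> {t\<^sub>1<..<t\<^sub>2} \<Longrightarrow> x (\<phi> t) = x' t \<and> y (\<phi> t) = y' t"
    and t: "t \<in> {t\<^sub>1<..<t\<^sub>2}"
  shows "\<kappa> (\<phi> t) = 0" and "p\<^sub>1 * sin (\<theta> (\<phi> t)) - p\<^sub>2 * cos (\<theta> (\<phi> t)) = 0"
    and "q\<^sub>3 t = 0" and "v t = 0"
proof -
  let ?J = "{t\<^sub>1<..<t\<^sub>2}"
  define B where "B = (\<lambda>s. p\<^sub>1 * sin (\<theta> s) - p\<^sub>2 * cos (\<theta> s))"
  have el_at: "(\<kappa> has_real_derivative B s) (at s)" "(x has_real_derivative cos (\<theta> s)) (at s)"
    "(y has_real_derivative sin (\<theta> s)) (at s)" "(\<theta> has_real_derivative \<kappa> s) (at s)"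
    if "s \<in> I" for s
  proof -
    have "s \<in> {a..b}" "at s within {a..b} = at s"
      using that I(2) at_within_Icc_at[of a s b] by auto
    with el show "(\<kappa> has_real_derivative B s) (at s)" "(x has_real_derivative cos (\<theta> s)) (at s)"
    "(y has_real_derivative sin (\<theta> s)) (at s)" "(\<theta> has_real_derivative \<kappa> s) (at s)"
      unfolding elastica_lift_def B_def by metis+
  qed
  have in_dom: "t \<in> {\<alpha>..\<beta>}" "at t within {\<alpha>..\<beta>} = at t" if "t \<in> ?J" for t
  proof -
    have "t \<in> {\<alpha><..<\<beta>}" using that J by blast
    then show "t \<in> {\<alpha>..\<beta>}" "at t within {\<alpha>..\<beta>} = at t" by (auto simp: at_within_Icc_at)
  qed
  have sr_at: "(q\<^sub>3 has_real_derivative w t * v t / \<xi>\<^sup>2) (at t)"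
    "(x' has_real_derivative w t / \<xi>\<^sup>2 * cos (\<psi> t)) (at t)"
    "(y' has_real_derivative w t / \<xi>\<^sup>2 * sin (\<psi> t)) (at t)"
    "(\<psi> has_real_derivative q\<^sub>3 t) (at t)"
    "(w has_real_derivative - (q\<^sub>3 t * v t)) (at t)"
    "(v has_real_derivative q\<^sub>3 t * w t) (at t)" if "t \<in> ?J" for t
    using sr_lift_derivs[OF sr in_dom(1)[OF that]] unfolding in_dom(2)[OF that] by blast+
  have chain: "((\<lambda>t. f (\<phi> t)) has_real_derivative m * (\<sigma> * w t / \<xi>\<^sup>2)) (at t)"
    if "t \<in> ?J" "(f has_real_derivative m) (at (\<phi> t))" for f m t
    using DERIV_chain2[of f m \<phi> t] that(2) \<phi>[OF that(1)] by blast
  have tangent: "cos (\<theta> (\<phi> t)) = \<sigma> * cos (\<psi> t)" "sin (\<theta> (\<phi> t)) = \<sigma> * sin (\<psi> t)"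
    if t: "t \<in> ?J" for t
  proof -
    have W: "w t \<noteq> 0" "\<xi> \<noteq> 0" and "\<phi> t \<in> I" using w0 in_dom(1)[OF t] \<open>\<xi> > 0\<close> \<phi>[OF t] by auto
    have cancel: "m = \<sigma> * n" if "m * (\<sigma> * w t / \<xi>\<^sup>2) = w t / \<xi>\<^sup>2 * n" for m n
    proof -
      have "m * \<sigma> = n" using that W by (simp add: field_simps)
      then have "\<sigma> * n = m * \<sigma>\<^sup>2" by (auto simp: power2_eq_square)
      then show ?thesis using \<sigma> by simp
    qed
    show "cos (\<theta> (\<phi> t)) = \<sigma> * cos (\<psi> t)"
      by (rule cancel, rule derivative_unique_open[of ?J t "\<lambda>t. x (\<phi> t)" x'])
         (use t xy chain[OF t el_at(2)] sr_at(2)[OF t] \<open>\<phi> t \<in> I\<close> in auto)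
    show "sin (\<theta> (\<phi> t)) = \<sigma> * sin (\<psi> t)"
      by (rule cancel, rule derivative_unique_open[of ?J t "\<lambda>t. y (\<phi> t)" y'])
         (use t xy chain[OF t el_at(3)] sr_at(3)[OF t] \<open>\<phi> t \<in> I\<close> in auto)
  qed
  have rel: "\<kappa> (\<phi> t) * (\<sigma> * w t) = \<xi>\<^sup>2 * q\<^sub>3 t"
    "B (\<phi> t) * w t = v t * (\<xi>\<^sup>2 + (\<kappa> (\<phi> t))\<^sup>2)" if "t \<in> ?J" for t
  proof -
    note c = curvature_relation[where I = I and J = ?J and \<theta> = \<theta> and \<kappa> = \<kappa> and \<psi> = \<psi> and q\<^sub>3 = q\<^sub>3
          and w = w and v = v and \<phi> = \<phi> and B = B, OF \<open>\<xi> > 0\<close> \<sigma> I(1) _ \<phi> el_at(4,1)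
          sr_at(4) sr_at(1) sr_at(5) w0[OF in_dom(1)] tangent that]
    show "\<kappa> (\<phi> t) * (\<sigma> * w t) = \<xi>\<^sup>2 * q\<^sub>3 t"
      "B (\<phi> t) * w t = v t * (\<xi>\<^sup>2 + (\<kappa> (\<phi> t))\<^sup>2)"
      by (rule c; simp)+
  qed
  obtain E where E: "\<And>s. s \<in> {a..b} \<Longrightarrow> p\<^sub>1 * cos (\<theta> s) + p\<^sub>2 * sin (\<theta> s) = E - (\<kappa> s)\<^sup>2 / 2"
    using elastica_energy[OF el] by blast
  obtain H where H: "\<And>t. t \<in> {\<alpha>..\<beta>} \<Longrightarrow> \<xi>\<^sup>2 * (w t)\<^sup>2 + (\<xi>\<^sup>2 * q\<^sub>3 t)\<^sup>2 = H"
    using sr_energy[OF sr \<open>\<xi> > 0\<close>] by blast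
  let ?r = "p\<^sub>1\<^sup>2 + p\<^sub>2\<^sup>2" and ?\<rho> = "q\<^sub>1\<^sup>2 + q\<^sub>2\<^sup>2"
  let ?K = "{k. H * (?r - (E - k\<^sup>2 / 2)\<^sup>2) = (?\<rho> * (\<xi>\<^sup>2 + k\<^sup>2) - H) * (\<xi>\<^sup>2 + k\<^sup>2)\<^sup>2}"
  have sextic: "\<kappa> (\<phi> t) \<in> ?K" if t: "t \<in> ?J" for t
  proof -
    have "\<phi> t \<in> {a..b}" using \<phi>[OF t] I(2) by force
    have "(p\<^sub>1 * cos (\<theta> (\<phi> t)) + p\<^sub>2 * sin (\<theta> (\<phi> t)))\<^sup>2 + (B (\<phi> t))\<^sup>2
        = ?r * ((sin (\<theta> (\<phi> t)))\<^sup>2 + (cos (\<theta> (\<phi> t)))\<^sup>2)"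
      unfolding B_def by algebra
    then have B2: "(E - (\<kappa> (\<phi> t))\<^sup>2 / 2)\<^sup>2 + (B (\<phi> t))\<^sup>2 = ?r"
      by (simp add: E[OF \<open>\<phi> t \<in> {a..b}\<close>])
    have w2: "(w t)\<^sup>2 * (\<xi>\<^sup>2 + (\<kappa> (\<phi> t))\<^sup>2) = H"
      using H[OF in_dom(1)[OF t]] \<sigma>
      unfolding rel(1)[OF t, symmetric] by (simp add: power_mult_distrib algebra_simps)
    have "(B (\<phi> t))\<^sup>2 * (w t)\<^sup>2 = (?\<rho> - (w t)\<^sup>2) * (\<xi>\<^sup>2 + (\<kappa> (\<phi> t))\<^sup>2)\<^sup>2"
      using rel(2)[OF t] sr_lift_norm[OF sr, of t] by algebra
    then have "(B (\<phi> t))\<^sup>2 * H = (?\<rho> * (\<xi>\<^sup>2 + (\<kappa> (\<phi> t))\<^sup>2) - H) * (\<xi>\<^sup>2 + (\<kappa> (\<phi> t))\<^sup>2)\<^sup>2"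
      unfolding w2[symmetric] by algebra
    moreover have "(B (\<phi> t))\<^sup>2 = ?r - (E - (\<kappa> (\<phi> t))\<^sup>2 / 2)\<^sup>2" using B2 by simp
    ultimately show ?thesis by (simp add: mult.commute)
  qed
  \<comment> \<open>A vanishing planar momentum would force \<open>w = 0\<close>.\<close>
  have "?\<rho> \<noteq> 0"
    using sr_lift_norm[OF sr, of t] w0[OF in_dom(1)[OF t]]
    by (metis sum_power2_eq_zero_iff)
  have "(\<lambda>t. \<kappa> (\<phi> t)) constant_on ?J"
  proof (rule continuous_finite_range_constant)
    show "continuous_on ?J (\<lambda>t. \<kappa> (\<phi> t))"
      using chain el_at(1) \<phi> by (meson DERIV_isCont continuous_at_imp_continuous_on)
    show "finite ((\<lambda>t. \<kappa> (\<phi> t)) ` ?J)"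
      using sextic by (intro finite_subset[OF _ finite_common_curvatures[OF \<open>?\<rho> \<noteq> 0\<close>]]) blast
  qed simp
  then obtain k where k: "\<And>t. t \<in> ?J \<Longrightarrow> \<kappa> (\<phi> t) = k"
    unfolding constant_on_def by blast
  have Bv: "B (\<phi> t) = 0 \<and> v t = 0" if t: "t \<in> ?J" for t
  proof -
    have "B (\<phi> t) * (\<sigma> * w t / \<xi>\<^sup>2) = 0"
      by (rule derivative_unique_open[of ?J t "\<lambda>t. \<kappa> (\<phi> t)" "\<lambda>_. k"])
         (use t k chain[OF t el_at(1)] \<phi>[OF t] in auto)
    moreover have "\<sigma> \<noteq> 0" using \<sigma> by auto
    ultimately have "B (\<phi> t) = 0" using w0[OF in_dom(1)[OF t]] \<open>\<xi> > 0\<close> by simp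
    moreover have "\<xi>\<^sup>2 + (\<kappa> (\<phi> t))\<^sup>2 \<noteq> 0"
      using \<open>\<xi> > 0\<close> by (simp add: sum_power2_eq_zero_iff)
    ultimately show ?thesis using rel(2)[OF t] by (metis mult_eq_0_iff)
  qed
  have "q\<^sub>3 t * w t = 0"
    by (rule derivative_unique_open[of ?J t v "\<lambda>_. 0"]) (use t Bv sr_at(6)[OF t] in auto)
  then show "q\<^sub>3 t = 0" using w0[OF in_dom(1)[OF t]] by simp
  then show "\<kappa> (\<phi> t) = 0" using rel(1)[OF t] w0[OF in_dom(1)[OF t]] \<sigma> by auto
  show "v t = 0" "p\<^sub>1 * sin (\<theta> (\<phi> t)) - p\<^sub>2 * cos (\<theta> (\<phi> t)) = 0"
    using Bv[OF t] by (simp_all add: B_def)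
qed

theorem theorem1:
  fixes \<xi> a b \<alpha> \<beta> c d S :: real
    and x y x' y' \<theta>' :: "real \<Rightarrow> real"
  assumes "\<xi> > 0" and "a < b" and "\<alpha> < \<beta>"
    and "elastica a b x y"
    and "sr_geodesic \<xi> \<alpha> \<beta> x' y' \<theta>'"
    and "\<forall>t\<in>{\<alpha>..\<beta>}. (vector_derivative x' (at t within {\<alpha>..\<beta>}))\<^sup>2 +
                     (vector_derivative y' (at t within {\<alpha>..\<beta>}))\<^sup>2 \<noteq> 0"
    and "S = planar_arclength \<alpha> \<beta> x' y' \<beta>"
    and "c < d" and "{c<..<d} \<subseteq> {a..b} \<inter> {0..S}"
    and "\<forall>s\<in>{c<..<d}. (x s, y s) =
           (x' (arclength_inverse \<alpha> \<beta> x' y' s), y' (arclength_inverse \<alpha> \<beta> x' y' s))"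
  shows "is_line_segment ((\<lambda>s. (x s, y s)) ` {a..b}) \<and>
         is_line_segment ((\<lambda>t. (x' t, y' t)) ` {\<alpha>..\<beta>})"
proof -
  note \<xi> = assms(1) and ab = assms(2) and \<alpha>\<beta> = assms(3)
  obtain p\<^sub>1 p\<^sub>2 \<theta> \<kappa> where el: "elastica_lift a b p\<^sub>1 p\<^sub>2 x y \<theta> \<kappa>"
    using elastica_lift_exists[OF assms(4)] .
  obtain q\<^sub>1 q\<^sub>2 q\<^sub>3 w v where sr: "sr_lift \<xi> \<alpha> \<beta> q\<^sub>1 q\<^sub>2 x' y' \<theta>' q\<^sub>3 w v"
    using sr_lift_exists[OF assms(5)] .
  have speed: "planar_speed \<alpha> \<beta> x' y' t = \<bar>w t\<bar> / \<xi>\<^sup>2" if "t \<in> {\<alpha>..\<beta>}" for t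
    using sr_planar_speed[OF sr \<alpha>\<beta> that] .
  have w0: "w t \<noteq> 0" if "t \<in> {\<alpha>..\<beta>}" for t
    using speed[OF that] assms(6) that by (auto simp: planar_speed_def)
  have cont_w: "continuous_on {\<alpha>..\<beta>} w"
    using sr_lift_derivs(5)[OF sr] by (meson DERIV_continuous continuous_on_eq_continuous_within)
  obtain \<sigma> where \<sigma>: "\<sigma>\<^sup>2 = 1" "\<And>t. t \<in> {\<alpha>..\<beta>} \<Longrightarrow> \<sigma> * w t = \<bar>w t\<bar>"
    using continuous_nonzero_sign[OF cont_w w0] by blast
  define \<phi> where "\<phi> = planar_arclength \<alpha> \<beta> x' y'"
  have \<phi>': "(\<phi> has_real_derivative \<bar>w t\<bar> / \<xi>\<^sup>2) (at t within {\<alpha>..\<beta>})" if t: "t \<in> {\<alpha>..\<beta>}" for t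
  proof -
    have "continuous_on {\<alpha>..\<beta>} (\<lambda>t. \<bar>w t\<bar> / \<xi>\<^sup>2)"
      using cont_w \<xi> by (auto intro!: continuous_intros)
    moreover have "continuous_on {\<alpha>..\<beta>} (planar_speed \<alpha> \<beta> x' y') \<longleftrightarrow>
        continuous_on {\<alpha>..\<beta>} (\<lambda>t. \<bar>w t\<bar> / \<xi>\<^sup>2)"
      by (rule continuous_on_cong) (simp_all add: speed)
    ultimately have "continuous_on {\<alpha>..\<beta>} (planar_speed \<alpha> \<beta> x' y')" by blast
    from integral_has_real_derivative[OF this t] show ?thesis
      by (simp add: speed[OF t] \<phi>_def planar_arclength_def[abs_def])
  qed
  have cont_\<phi>: "continuous_on {\<alpha>..\<beta>} \<phi>"
    using \<phi>' by (meson DERIV_continuous continuous_on_eq_continuous_within)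
  have mono: "\<phi> s < \<phi> t" if "s \<in> {\<alpha>..\<beta>}" "t \<in> {\<alpha>..\<beta>}" "s < t" for s t
  proof (rule DERIV_pos_imp_increasing_open[OF \<open>s < t\<close>])
    fix r assume "s < r" "r < t"
    then have r: "\<alpha> < r" "r < \<beta>" using that by auto
    then show "\<exists>m. (\<phi> has_real_derivative m) (at r) \<and> 0 < m"
      using \<phi>'[of r] w0[of r] \<xi> by (auto simp: at_within_Icc_at intro!: exI[of _ "\<bar>w r\<bar> / \<xi>\<^sup>2"])
  qed (use that in \<open>auto intro: continuous_on_subset[OF cont_\<phi>]\<close>)
  have inj: "inj_on \<phi> {\<alpha>..\<beta>}"
    by (rule inj_onI) (metis mono less_irrefl linorder_cases)
  have "\<phi> \<alpha> = 0" by (simp add: \<phi>_def planar_arclength_def)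
  have "\<phi> \<beta> = S" using assms(7) by (simp add: \<phi>_def)
  have hits: "\<exists>t\<in>{\<alpha>..\<beta>}. \<phi> t = s" if "s \<in> {c<..<d}" for s
    using IVT'[of \<phi> \<alpha> s \<beta>] that assms(9) \<alpha>\<beta> cont_\<phi> \<open>\<phi> \<alpha> = 0\<close> \<open>\<phi> \<beta> = S\<close> by force
  \<comment> \<open>A smaller interval of arclengths is taken so that its end points, too, are values of \<open>\<phi>\<close>; its
    preimage is then an open interval between two parameters of the geodesic.\<close>
  obtain c\<^sub>1 d\<^sub>1 where cd: "c < c\<^sub>1" "c\<^sub>1 < d\<^sub>1" "d\<^sub>1 < d"
    using \<open>c < d\<close> dense by meson
  then obtain t\<^sub>1 t\<^sub>2 where t12: "t\<^sub>1 \<in> {\<alpha>..\<beta>}" "\<phi> t\<^sub>1 = c\<^sub>1" "t\<^sub>2 \<in> {\<alpha>..\<beta>}" "\<phi> t\<^sub>2 = d\<^sub>1"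
    using hits[of c\<^sub>1] hits[of d\<^sub>1] by auto
  then have "t\<^sub>1 < t\<^sub>2" using mono[of t\<^sub>2 t\<^sub>1] cd by (cases t\<^sub>1 t\<^sub>2 rule: linorder_cases) auto
  have J: "{t\<^sub>1<..<t\<^sub>2} \<subseteq> {\<alpha><..<\<beta>}" using t12 by auto
  have I: "{c<..<d} \<subseteq> {a<..<b}"
    using assms(9) \<open>c < d\<close> by (auto simp: greaterThanLessThan_subseteq_atLeastAtMost_iff)
  have \<phi>J: "\<phi> t \<in> {c<..<d} \<and> (\<phi> has_real_derivative \<sigma> * w t / \<xi>\<^sup>2) (at t)"
    if t: "t \<in> {t\<^sub>1<..<t\<^sub>2}" for t
  proof -
    have t': "\<alpha> < t" "t < \<beta>" using t t12 by auto
    then have "c\<^sub>1 < \<phi> t" "\<phi> t < d\<^sub>1" using mono[of t\<^sub>1 t] mono[of t t\<^sub>2] t t12 by auto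
    then show ?thesis
      using \<phi>'[of t] t' \<sigma>(2)[of t] cd by (simp add: at_within_Icc_at)
  qed
  have xy: "x (\<phi> t) = x' t \<and> y (\<phi> t) = y' t" if t: "t \<in> {t\<^sub>1<..<t\<^sub>2}" for t
  proof -
    have "arclength_inverse \<alpha> \<beta> x' y' (\<phi> t) = t"
      using the_inv_into_f_f[OF inj, of t] t t12 by (simp add: arclength_inverse_def \<phi>_def)
    then show ?thesis using assms(10) \<phi>J[OF t] by auto
  qed
  obtain t\<^sub>0 where t0: "t\<^sub>0 \<in> {t\<^sub>1<..<t\<^sub>2}"
    using \<open>t\<^sub>1 < t\<^sub>2\<close> dense by auto
  note flat = overlap_inflection[OF el sr \<xi> \<sigma>(1) w0 \<open>t\<^sub>1 < t\<^sub>2\<close> J open_greaterThanLessThan I \<phi>J xy t0]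
  have dom: "\<phi> t\<^sub>0 \<in> {a..b}" "t\<^sub>0 \<in> {\<alpha>..\<beta>}"
    using \<phi>J[OF t0] assms(9) t0 t12 by auto
  show ?thesis
    using elastica_straight[OF el ab dom(1) flat(1,2)]
      sr_straight[OF sr \<xi> \<alpha>\<beta> dom(2) flat(3,4) w0[OF dom(2)]] by blast
qed

end
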